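(* Let $k>2$, $n\ge1$, let $\sigma:Z_k\to Z_k$ be a mapping, and let $\psi_\sigma:P_k^n\to P_k^n$ be defined by $\psi_\sigma(f)(\mathbf a)=\sigma(f(\mathbf a))$ for all $\mathbf a\in Z_k^n$. Then $\psi_\sigma\in IM_k^n$ and $\psi_\sigma\in SB_k^n$ if and only if $\sigma$ is a permutation of $Z_k$.
   Context: $Z_k=\{0,\dots,k-1\}$; $P_k^n$ is the set of functions $Z_k^n\to Z_k$ in variables $x_1,\dots,x_n$; $S_n$, $S_{Z_k}$ are the symmetric groups on $\{1,\dots,n\}$ and $Z_k$. $x_i$ is essential in $f$ if changing only the value of $x_i$ can change the value of $f$; $Ess(f)$, $ess(f)=|Ess(f)|$; $range(f)$ is the set of values of $f$. For $x_i\in Ess(f)$, $f(x_i=c)$ is obtained by substituting $c$ for $x_i$, written $f(x_i=c)\prec f$; $\preceq$ is the reflexive–transitive closure; $sub_m(f)$ is the number of $g\preceq f$ with $ess(g)=m$. Equivalences on $P_k^n$: $f\simeq_{imp}g$ if $ess(f)=ess(g)\le1$, or if $ess(f)=n>1$ (essential variables written $x_1,\dots,x_n$, likewise for $g$) and there are $\pi\in S_n$, $\sigma_i\in S_{Z_k}$ with $f(x_i=j)\simeq_{imp}g(x_{\pi(i)}=\sigma_i(j))$ for all $i,j$ (recursive definition); $f\simeq_{sub}g$ if $ess(f)=ess(g)=0$, or $ess(f)=ess(g)=1$ and $range(f)=range(g)$, or $ess(f)=n>1$ and $sub_m(f)=sub_m(g)$ for $m=0,\dots,n$. $IM_k^n$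 (resp. $SB_k^n$) is the group of all invertible maps $\varphi:P_k^n\to P_k^n$ such that $f\simeq_{imp}\varphi(f)$ (resp. $f\simeq_{sub}\varphi(f)$) for every $f\in P_k^n$.
   Formalization: For functions with one essential variable, the condition range(f)=range(g) in the definition of sub-equivalence is replaced by |range(f)|=|range(g)|; with equal value sets the claim fails, e.g. for σ=(1 2) and a function with values {0,1}. *)

theory Defs
  imports "HOL-Algebra.Bij"
begin

definition Z :: "nat \<Rightarrow> nat set" where
  "Z k = {..<k}"

definition tuples :: "nat \<Rightarrow> nat \<Rightarrow> (nat \<Rightarrow> nat) set" where
  "tuples k n = {1..n} \<rightarrow>\<^sub>E Z k"

text \<open>Tuples and functions are extensional (undefined outside their domain), so that
  equality in HOL is equality of functions on \<open>Z\<^sub>k\<^sup>n\<close> and \<open>P k n\<close> has exactly \<open>k ^ (k ^ n)\<close> elements.\<close>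

definition P :: "nat \<Rightarrow> nat \<Rightarrow> ((nat \<Rightarrow> nat) \<Rightarrow> nat) set" where
  "P k n = tuples k n \<rightarrow>\<^sub>E Z k"

text \<open>The index \<open>i\<close> stands for the variable \<open>x\<^sub>i\<close>.\<close>

definition Ess :: "nat \<Rightarrow> nat \<Rightarrow> ((nat \<Rightarrow> nat) \<Rightarrow> nat) \<Rightarrow> nat set" where
  "Ess k n f = {i \<in> {1..n}. \<exists>a \<in> tuples k n. \<exists>c \<in> Z k. f (a(i := c)) \<noteq> f a}"

definition ess :: "nat \<Rightarrow> nat \<Rightarrow> ((nat \<Rightarrow> nat) \<Rightarrow> nat) \<Rightarrow> nat" where
  "ess k n f = card (Ess k n f)"

definition range_of :: "nat \<Rightarrow> nat \<Rightarrow> ((nat \<Rightarrow> nat) \<Rightarrow> nat) \<Rightarrow> nat set" where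
  "range_of k n f = f ` tuples k n"

text \<open>\<open>f(x\<^sub>i = c)\<close> is kept as an element of \<open>P k n\<close> in which \<open>x\<^sub>i\<close> is no longer essential.\<close>

definition subst :: "nat \<Rightarrow> nat \<Rightarrow> ((nat \<Rightarrow> nat) \<Rightarrow> nat) \<Rightarrow> nat \<Rightarrow> nat \<Rightarrow> ((nat \<Rightarrow> nat) \<Rightarrow> nat)" where
  "subst k n f i c = (\<lambda>a \<in> tuples k n. f (a(i := c)))"

definition simple_subfun ::
  "nat \<Rightarrow> nat \<Rightarrow> ((nat \<Rightarrow> nat) \<Rightarrow> nat) \<Rightarrow> ((nat \<Rightarrow> nat) \<Rightarrow> nat) \<Rightarrow> bool" where
  "simple_subfun k n g f \<longleftrightarrow> (\<exists>i \<in> Ess k n f. \<exists>c \<in> Z k. g = subst k n f i c)"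

definition subfun ::
  "nat \<Rightarrow> nat \<Rightarrow> ((nat \<Rightarrow> nat) \<Rightarrow> nat) \<Rightarrow> ((nat \<Rightarrow> nat) \<Rightarrow> nat) \<Rightarrow> bool" where
  "subfun k n = (simple_subfun k n)\<^sup>*\<^sup>*"

definition sub_count :: "nat \<Rightarrow> nat \<Rightarrow> nat \<Rightarrow> ((nat \<Rightarrow> nat) \<Rightarrow> nat) \<Rightarrow> nat" where
  "sub_count k n m f = card {g. subfun k n g f \<and> ess k n g = m}"

text \<open>The recursion strictly decreases the number of essential variables, so the inductive
  predicate is the recursively defined relation. Numbering the essential variables of \<open>f\<close> and of
  \<open>g\<close> by \<open>1, \<dots>, m\<close> turns \<open>\<pi> \<in> S\<^sub>m\<close> into a bijection between the two sets of essential variables.\<close>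

inductive imp_equiv ::
  "nat \<Rightarrow> nat \<Rightarrow> ((nat \<Rightarrow> nat) \<Rightarrow> nat) \<Rightarrow> ((nat \<Rightarrow> nat) \<Rightarrow> nat) \<Rightarrow> bool" for k n where
  base: "ess k n f = ess k n g \<Longrightarrow> ess k n f \<le> 1 \<Longrightarrow> imp_equiv k n f g"
| step: "ess k n f = ess k n g \<Longrightarrow> ess k n f > 1 \<Longrightarrow>
    bij_betw \<pi> (Ess k n f) (Ess k n g) \<Longrightarrow>
    (\<And>i. i \<in> Ess k n f \<Longrightarrow> bij_betw (\<sigma> i) (Z k) (Z k)) \<Longrightarrow>
    (\<And>i j. i \<in> Ess k n f \<Longrightarrow> j \<in> Z k \<Longrightarrow>
      imp_equiv k n (subst k n f i j) (subst k n g (\<pi> i) (\<sigma> i j))) \<Longrightarrow>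
    imp_equiv k n f g"

text \<open>For one essential variable, \<open>range(f) = range(g)\<close> is read as ``equally many values'', that is
  \<open>sub\<^sub>0(f) = sub\<^sub>0(g)\<close>, in line with the case of more than one essential variable. Requiring the
  two value sets to coincide would be strictly finer, and composing with the transposition of
  \<open>1\<close> and \<open>2\<close> would then not preserve the class of a function of one essential variable with
  values \<open>{0, 1}\<close>, although the transposition is a permutation.\<close>

definition sub_equiv ::
  "nat \<Rightarrow> nat \<Rightarrow> ((nat \<Rightarrow> nat) \<Rightarrow> nat) \<Rightarrow> ((nat \<Rightarrow> nat) \<Rightarrow> nat) \<Rightarrow> bool" where
  "sub_equiv k n f g \<longleftrightarrow>
     ess k n f = 0 \<and> ess k n g = 0 \<or>
     ess k n f = 1 \<and> ess k n g = 1 \<and> card (range_of k n f) = card (range_of k n g) \<or>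
     ess k n f > 1 \<and> (\<forall>m \<in> {0..ess k n f}. sub_count k n m f = sub_count k n m g)"

text \<open>\<open>BijGroup (P k n)\<close> is the group, under composition, of all bijections of \<open>P k n\<close> onto itself.\<close>

definition IM :: "nat \<Rightarrow> nat \<Rightarrow> (((nat \<Rightarrow> nat) \<Rightarrow> nat) \<Rightarrow> ((nat \<Rightarrow> nat) \<Rightarrow> nat)) monoid" where
  "IM k n = (BijGroup (P k n))\<lparr>carrier :=
     {\<phi> \<in> carrier (BijGroup (P k n)). \<forall>f \<in> P k n. imp_equiv k n f (\<phi> f)}\<rparr>"

definition SB :: "nat \<Rightarrow> nat \<Rightarrow> (((nat \<Rightarrow> nat) \<Rightarrow> nat) \<Rightarrow> ((nat \<Rightarrow> nat) \<Rightarrow> nat)) monoid" where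
  "SB k n = (BijGroup (P k n))\<lparr>carrier :=
     {\<phi> \<in> carrier (BijGroup (P k n)). \<forall>f \<in> P k n. sub_equiv k n f (\<phi> f)}\<rparr>"

definition psi ::
  "nat \<Rightarrow> nat \<Rightarrow> (nat \<Rightarrow> nat) \<Rightarrow> ((nat \<Rightarrow> nat) \<Rightarrow> nat) \<Rightarrow> ((nat \<Rightarrow> nat) \<Rightarrow> nat)" where
  "psi k n \<sigma> = (\<lambda>f \<in> P k n. \<lambda>a \<in> tuples k n. \<sigma> (f a))"

end

theory Submission
  imports Defs
begin

text \<open>Composing with an injective \<open>\<sigma>\<close> keeps every essential variable and commutes with the
  substitution of constants, so \<open>\<psi>\<^sub>\<sigma>\<close> maps the subfunctions of \<open>f\<close> bijectively onto those of
  \<open>\<psi>\<^sub>\<sigma>(f)\<close>, and \<open>imp_equiv\<close> holds with identity witnesses by induction on \<open>ess(f)\<close>. Conversely, a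
  surjective \<open>\<psi>\<^sub>\<sigma>\<close> attains every constant function, hence \<open>\<sigma>\<close> is surjective on the finite set
  \<open>Z\<^sub>k\<close>.\<close>

section \<open>Finiteness, and closure under substitution of constants\<close>

lemma finite_tuples: "finite (tuples k n)"
  unfolding tuples_def Z_def by (intro finite_PiE) auto

lemma finite_P: "finite (P k n)"
  unfolding P_def by (intro finite_PiE finite_tuples) (auto simp: Z_def)

lemma tuples_nonempty: "0 < k \<Longrightarrow> tuples k n \<noteq> {}"
  by (auto simp: tuples_def Z_def PiE_eq_empty_iff)

lemma fun_upd_in_tuples:
  "a \<in> tuples k n \<Longrightarrow> i \<in> {1..n} \<Longrightarrow> c \<in> Z k \<Longrightarrow> a(i := c) \<in> tuples k n"
  by (auto simp: tuples_def PiE_def extensional_def)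

lemma subst_in_P:
  assumes "f \<in> P k n" "i \<in> {1..n}" "c \<in> Z k"
  shows "subst k n f i c \<in> P k n"
  using assms fun_upd_in_tuples[OF _ assms(2,3)] unfolding P_def subst_def by auto

lemma Ess_subset: "Ess k n f \<subseteq> {1..n}"
  by (auto simp: Ess_def)

lemma finite_Ess: "finite (Ess k n f)"
  by (rule finite_subset[OF Ess_subset]) simp

text \<open>Updates at two different positions commute, so if \<open>a\<close> witnesses that
  \<open>x_j\<close> is essential after the substitution, then \<open>a(i := c)\<close> witnesses it
  for \<open>f\<close>.\<close>

lemma Ess_subst_subset:
  assumes "i \<in> {1..n}" "c \<in> Z k"
  shows "Ess k n (subst k n f i c) \<subseteq> Ess k n f - {i}"
proof
  fix j assume "j \<in> Ess k n (subst k n f i c)"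
  then obtain a d where j: "j \<in> {1..n}" and a: "a \<in> tuples k n" and d: "d \<in> Z k"
    and neq: "subst k n f i c (a(j := d)) \<noteq> subst k n f i c a"
    unfolding Ess_def by blast
  have neq': "f (a(j := d, i := c)) \<noteq> f (a(i := c))"
    using neq a fun_upd_in_tuples[OF a j d] by (simp add: subst_def)
  \<comment> \<open>For \<open>j = i\<close> the later update would overwrite the change from
    \<open>a\<close> to \<open>a(j := d)\<close>.\<close>
  then have "j \<noteq> i" by auto
  moreover from this neq' have "f ((a(i := c))(j := d)) \<noteq> f (a(i := c))"
    by (simp add: fun_upd_twist)
  ultimately show "j \<in> Ess k n f - {i}"
    using j d fun_upd_in_tuples[OF a assms] unfolding Ess_def by blast
qed

text \<open>The variable substituted for is lost and none is gained. This is the decrease behind the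
  induction on \<open>ess k n f\<close> in \<open>imp_equiv_psi\<close>.\<close>

lemma ess_subst_less:
  assumes "i \<in> Ess k n f" "c \<in> Z k"
  shows "ess k n (subst k n f i c) < ess k n f"
proof -
  have "Ess k n (subst k n f i c) \<subset> Ess k n f"
    using Ess_subst_subset[of i n c k f] assms Ess_subset[of k n f] by blast
  then show ?thesis
    unfolding ess_def by (simp add: finite_Ess psubset_card_mono)
qed

lemma simple_subfun_in_P: "simple_subfun k n g f \<Longrightarrow> f \<in> P k n \<Longrightarrow> g \<in> P k n"
  using Ess_subset subst_in_P unfolding simple_subfun_def by blast

lemma subfun_in_P:
  assumes "subfun k n g f" "f \<in> P k n"
  shows "g \<in> P k n"
  using assms(1) unfolding subfun_def
  by (induction rule: converse_rtranclp_induct) (use assms(2) simple_subfun_in_P in blast)+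

section \<open>Pointwise behaviour of \<open>psi k n \<sigma>\<close>\<close>

lemma P_apply: "f \<in> P k n \<Longrightarrow> a \<in> tuples k n \<Longrightarrow> f a \<in> Z k"
  by (auto simp: P_def)

lemma psi_apply: "f \<in> P k n \<Longrightarrow> a \<in> tuples k n \<Longrightarrow> psi k n \<sigma> f a = \<sigma> (f a)"
  by (simp add: psi_def)

lemma psi_in_P:
  assumes "\<sigma> \<in> Z k \<rightarrow> Z k" "f \<in> P k n"
  shows "psi k n \<sigma> f \<in> P k n"
  using assms P_apply[OF assms(2)] by (auto simp: psi_def P_def)

lemma psi_subst:
  assumes "f \<in> P k n" "i \<in> {1..n}" "c \<in> Z k"
  shows "subst k n (psi k n \<sigma> f) i c = psi k n \<sigma> (subst k n f i c)"
proof
  fix a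
  show "subst k n (psi k n \<sigma> f) i c a = psi k n \<sigma> (subst k n f i c) a"
    \<comment> \<open>Outside \<open>tuples k n\<close> both sides are
      \<open>undefined\<close>.\<close>
    using assms(1) subst_in_P[OF assms] fun_upd_in_tuples[OF _ assms(2,3)]
    by (cases "a \<in> tuples k n") (simp_all add: psi_def subst_def)
qed

lemma Ess_psi:
  assumes "inj_on \<sigma> (Z k)" "f \<in> P k n"
  shows "Ess k n (psi k n \<sigma> f) = Ess k n f"
proof -
  have "psi k n \<sigma> f (a(i := c)) = psi k n \<sigma> f a \<longleftrightarrow> f (a(i := c)) = f a"
    if "i \<in> {1..n}" "a \<in> tuples k n" "c \<in> Z k" for i a c
    using that assms fun_upd_in_tuples[of a k n i c]
    by (simp add: psi_apply inj_on_eq_iff[OF assms(1)] P_apply)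
  then show ?thesis
    unfolding Ess_def by blast
qed

lemma ess_psi: "inj_on \<sigma> (Z k) \<Longrightarrow> f \<in> P k n \<Longrightarrow> ess k n (psi k n \<sigma> f) = ess k n f"
  by (simp add: ess_def Ess_psi)

lemma inj_on_psi:
  assumes "inj_on \<sigma> (Z k)"
  shows "inj_on (psi k n \<sigma>) (P k n)"
proof (rule inj_onI)
  fix f g assume f: "f \<in> P k n" and g: "g \<in> P k n" and eq: "psi k n \<sigma> f = psi k n \<sigma> g"
  have "f a = g a" if "a \<in> tuples k n" for a
    using fun_cong[OF eq, of a] that f g assms by (simp add: psi_apply P_apply inj_on_eq_iff)
  then show "f = g"
    using f g unfolding P_def by (blast intro: PiE_ext)
qed

section \<open>Bijectivity of \<open>psi k n \<sigma>\<close> and of \<open>\<sigma>\<close>\<close>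

lemma psi_in_carrier_BijGroup:
  assumes "bij_betw \<sigma> (Z k) (Z k)"
  shows "psi k n \<sigma> \<in> carrier (BijGroup (P k n))"
proof -
  have inj: "inj_on (psi k n \<sigma>) (P k n)"
    using assms by (intro inj_on_psi) (rule bij_betw_imp_inj_on)
  have "psi k n \<sigma> ` P k n \<subseteq> P k n"
    using psi_in_P[OF bij_betw_imp_funcset[OF assms]] by blast
  \<comment> \<open>An injective map of a finite set into itself is onto.\<close>
  then have "bij_betw (psi k n \<sigma>) (P k n) (P k n)"
    using inj finite_P endo_inj_surj unfolding bij_betw_def by blast
  then show ?thesis
    \<comment> \<open>\<open>Bij\<close> also demands extensionality, which the restricted lambda in
      \<open>psi\<close> supplies.\<close>
    by (simp add: BijGroup_def Bij_def psi_def)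
qed

lemma bij_betw_of_psi_in_carrier_BijGroup:
  assumes "0 < k" "\<sigma> \<in> Z k \<rightarrow> Z k" "psi k n \<sigma> \<in> carrier (BijGroup (P k n))"
  shows "bij_betw \<sigma> (Z k) (Z k)"
proof -
  \<comment> \<open>Some point is needed at which to evaluate a preimage of a constant function; any
    tuple will do.\<close>
  obtain a where a: "a \<in> tuples k n"
    using tuples_nonempty[OF assms(1)] by blast
  have "Z k \<subseteq> \<sigma> ` Z k"
  proof
    fix c assume "c \<in> Z k"
    then have "(\<lambda>a \<in> tuples k n. c) \<in> psi k n \<sigma> ` P k n"
      using assms(3) by (auto simp: BijGroup_def Bij_def bij_betw_def P_def)
    then obtain f where f: "f \<in> P k n" and eq: "(\<lambda>a \<in> tuples k n. c) = psi k n \<sigma> f"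
      by blast
    have "c = \<sigma> (f a)"
      using fun_cong[OF eq, of a] a f by (simp add: psi_apply)
    then show "c \<in> \<sigma> ` Z k"
      using P_apply[OF f a] by blast
  qed
  moreover have "\<sigma> ` Z k \<subseteq> Z k"
    using assms(2) by blast
  moreover have "finite (Z k)"
    by (simp add: Z_def)
  ultimately show ?thesis
    using finite_surj_inj unfolding bij_betw_def by blast
qed

section \<open>Preservation of \<open>imp_equiv\<close>\<close>

lemma imp_equiv_psi:
  assumes "inj_on \<sigma> (Z k)"
  shows "f \<in> P k n \<Longrightarrow> imp_equiv k n f (psi k n \<sigma> f)"
proof (induction "ess k n f" arbitrary: f rule: less_induct)
  case less
  show ?case
  proof (cases "ess k n f \<le> 1")
    case True
    then show ?thesis
      using ess_psi[OF assms less.prems] by (simp add: imp_equiv.base)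
  next
    case False
    have "imp_equiv k n (subst k n f i j) (subst k n (psi k n \<sigma> f) i j)"
      if i: "i \<in> Ess k n f" and j: "j \<in> Z k" for i j
    proof -
      have i': "i \<in> {1..n}"
        using i Ess_subset by blast
      show ?thesis
        \<comment> \<open>The induction hypothesis compares the subfunction with its own image under
          \<open>psi\<close>, which by \<open>psi_subst\<close> is the corresponding subfunction of
          the image of \<open>f\<close>.\<close>
        using less.hyps[OF ess_subst_less[OF i j] subst_in_P[OF less.prems i' j]]
        by (simp add: psi_subst[OF less.prems i' j])
    qed
    then show ?thesis
      using False ess_psi[OF assms less.prems] Ess_psi[OF assms less.prems]
        imp_equiv.step[of k n f "psi k n \<sigma> f" "\<lambda>i. i" "\<lambda>i j. j"]
      by (simp add: bij_betw_def)
  qed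
qed

section \<open>Subfunctions and preservation of \<open>sub_equiv\<close>\<close>

lemma simple_subfun_psi_iff:
  assumes "inj_on \<sigma> (Z k)" "f \<in> P k n"
  shows "simple_subfun k n h (psi k n \<sigma> f) \<longleftrightarrow> (\<exists>g. simple_subfun k n g f \<and> h = psi k n \<sigma> g)"
proof -
  have "i \<in> Ess k n f \<Longrightarrow> i \<in> {1..n}" for i
    using Ess_subset by blast
  then show ?thesis
    unfolding simple_subfun_def Ess_psi[OF assms] using psi_subst[OF assms(2)] by metis
qed

text \<open>Chains of substitutions are lifted and projected one link at a time. The induction
  extends a chain at its smaller end, so that \<open>f\<close> stays fixed and every intermediate
  function is a subfunction of \<open>f\<close>, hence in \<open>P k n\<close>.\<close>

lemma subfun_psi_iff:
  assumes "inj_on \<sigma> (Z k)" "f \<in> P k n"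
  shows "subfun k n h (psi k n \<sigma> f) \<longleftrightarrow> (\<exists>g. subfun k n g f \<and> h = psi k n \<sigma> g)"
proof
  assume "subfun k n h (psi k n \<sigma> f)"
  then show "\<exists>g. subfun k n g f \<and> h = psi k n \<sigma> g"
    unfolding subfun_def
  proof (induction rule: converse_rtranclp_induct)
    case base
    then show ?case by blast
  next
    case (step h' h)
    then obtain g where g: "subfun k n g f" "h = psi k n \<sigma> g"
      unfolding subfun_def by blast
    then obtain g' where "simple_subfun k n g' g" "h' = psi k n \<sigma> g'"
      using step.hyps(1) simple_subfun_psi_iff[OF assms(1) subfun_in_P[OF g(1) assms(2)]] by blast
    then show ?case
      using g(1) unfolding subfun_def by (blast intro: converse_rtranclp_into_rtranclp)
  qed
next
  assume "\<exists>g. subfun k n g f \<and> h = psi k n \<sigma> g"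
  then obtain g where g: "subfun k n g f" and h: "h = psi k n \<sigma> g"
    by blast
  from g show "subfun k n h (psi k n \<sigma> f)"
    unfolding h subfun_def
  proof (induction rule: converse_rtranclp_induct)
    case base
    then show ?case by blast
  next
    case (step g' g)
    then have "simple_subfun k n (psi k n \<sigma> g') (psi k n \<sigma> g)"
      using simple_subfun_psi_iff[OF assms(1)] subfun_in_P[OF _ assms(2)] unfolding subfun_def
      by blast
    then show ?case
      using step.IH by (rule converse_rtranclp_into_rtranclp)
  qed
qed

lemma sub_count_psi:
  assumes "inj_on \<sigma> (Z k)" "f \<in> P k n"
  shows "sub_count k n m (psi k n \<sigma> f) = sub_count k n m f"
proof -
  \<comment> \<open>\<open>psi\<close> is injective on \<open>P k n\<close> only, so the counted
    subfunctions must lie there.\<close>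
  have sub: "{g. subfun k n g f \<and> ess k n g = m} \<subseteq> P k n"
    using subfun_in_P assms(2) by blast
  have "{h. subfun k n h (psi k n \<sigma> f) \<and> ess k n h = m} =
      psi k n \<sigma> ` {g. subfun k n g f \<and> ess k n g = m}"
    using subfun_psi_iff[OF assms] ess_psi[OF assms(1)] subfun_in_P[OF _ assms(2)] by auto
  then show ?thesis
    unfolding sub_count_def
    using card_image[OF inj_on_subset[OF inj_on_psi[OF assms(1)] sub]] by simp
qed

lemma card_range_of_psi:
  assumes "inj_on \<sigma> (Z k)" "f \<in> P k n"
  shows "card (range_of k n (psi k n \<sigma> f)) = card (range_of k n f)"
proof -
  have "range_of k n (psi k n \<sigma> f) = \<sigma> ` range_of k n f"
    using psi_apply[OF assms(2)] by (simp add: range_of_def image_image)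
  moreover have "range_of k n f \<subseteq> Z k"
    using P_apply[OF assms(2)] by (auto simp: range_of_def)
  ultimately show ?thesis
    using inj_on_subset[OF assms(1)] by (simp add: card_image)
qed

lemma sub_equiv_psi:
  assumes "inj_on \<sigma> (Z k)" "f \<in> P k n"
  shows "sub_equiv k n f (psi k n \<sigma> f)"
  \<comment> \<open>After rewriting, all comparisons are between equal terms, and what remains is
    that \<open>ess k n f\<close> is 0, 1 or greater.\<close>
  unfolding sub_equiv_def ess_psi[OF assms] sub_count_psi[OF assms] card_range_of_psi[OF assms]
  by auto

theorem theorem4p2:
  fixes k n :: nat and \<sigma> :: "nat \<Rightarrow> nat"
  assumes "k > 2" and "n \<ge> 1" and "\<sigma> \<in> Z k \<rightarrow> Z k"
  shows "psi k n \<sigma> \<in> carrier (IM k n) \<and> psi k n \<sigma> \<in> carrier (SB k n)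
    \<longleftrightarrow> bij_betw \<sigma> (Z k) (Z k)"
proof
  assume "psi k n \<sigma> \<in> carrier (IM k n) \<and> psi k n \<sigma> \<in> carrier (SB k n)"
  \<comment> \<open>Membership in the carrier of \<open>IM k n\<close> includes being a bijection of
    \<open>P k n\<close>.\<close>
  then show "bij_betw \<sigma> (Z k) (Z k)"
    using assms by (intro bij_betw_of_psi_in_carrier_BijGroup) (auto simp: IM_def)
next
  assume bij: "bij_betw \<sigma> (Z k) (Z k)"
  then have "inj_on \<sigma> (Z k)"
    by (rule bij_betw_imp_inj_on)
  then show "psi k n \<sigma> \<in> carrier (IM k n) \<and> psi k n \<sigma> \<in> carrier (SB k n)"
    using psi_in_carrier_BijGroup[OF bij] imp_equiv_psi sub_equiv_psi by (simp add: IM_def SB_def)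
qed

end
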